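(* Let $L$ be a finite lattice, and let $m$ be a tab of $L$ in the covering multi-diamond $[o,i]$. Let $K = L \setminus \{m\}$, a sublattice of $L$. Let $\alpha$ be a congruence of $K$ and let $\beta = \mathrm{con}_L(\alpha)$. Then \[ \beta|_K = \begin{cases} \alpha, & \text{if } o \not\equiv i \pmod{\beta};\\ \alpha \vee_K \mathrm{con}_K(o,i), & \text{otherwise.}\end{cases} \]
   Context: A multi-diamond is a lattice isomorphic to $\mathsf{M}_n$, the $(n+2)$-element modular lattice of length 2 with $n$ atoms, for some integer $n\ge 3$. A covering multi-diamond in a lattice $L$ is an interval of $L$ isomorphic to $\mathsf{M}_n$ for some $n\ge 3$. An element $m\in L$ is a tab of $L$ if it is doubly-irreducible (it has exactly one lower cover and exactly one upper cover in $L$) and it is in a covering multi-diamond $[o,i]$ of $L$; then $o$ is the unique lower cover and $i$ the unique upper cover of $m$. $\mathrm{con}_L(\alpha)$ is the least congruence of $L$ containing $\alpha$; $\mathrm{con}_K(o,i)$ is the least congruence of $K$ collapsing $o$ and $i$; $\beta|_K$ is the restriction $\beta\cap K^2$; $\vee_K$ is the join in the congruence lattice of $K$. *)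

theory Defs
  imports Main
begin

(* A lattice is a type of class lattice; its sublattices are sets closed under
   sup and inf, and a sublattice is itself regarded as a lattice. *)

definition sublattice :: "'a::lattice set \<Rightarrow> bool" where
  "sublattice S \<longleftrightarrow> (\<forall>x\<in>S. \<forall>y\<in>S. sup x y \<in> S \<and> inf x y \<in> S)"

definition lattice_iso :: "('a::lattice \<Rightarrow> 'b::lattice) \<Rightarrow> 'a set \<Rightarrow> 'b set \<Rightarrow> bool" where
  "lattice_iso f A B \<longleftrightarrow> bij_betw f A B \<and>
     (\<forall>x\<in>A. \<forall>y\<in>A. f (sup x y) = sup (f x) (f y) \<and> f (inf x y) = inf (f x) (f y))"

definition isomorphic_lattices :: "'a::lattice set \<Rightarrow> 'b::lattice set \<Rightarrow> bool" where
  "isomorphic_lattices A B \<longleftrightarrow> (\<exists>f. lattice_iso f A B)"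


(* The lattice of length 2 with countably many atoms; every M_n is the sublattice
   formed by the bounds and the first n atoms. *)

datatype diamond = Zero | Atom nat | One

instantiation diamond :: lattice
begin

definition less_eq_diamond :: "diamond \<Rightarrow> diamond \<Rightarrow> bool" where
  "x \<le> y \<longleftrightarrow> x = Zero \<or> y = One \<or> x = y"

definition less_diamond :: "diamond \<Rightarrow> diamond \<Rightarrow> bool" where
  "x < y \<longleftrightarrow> x \<le> y \<and> x \<noteq> (y::diamond)"

definition sup_diamond :: "diamond \<Rightarrow> diamond \<Rightarrow> diamond" where
  "sup x y = (if x \<le> y then y else if y \<le> x then x else One)"

definition inf_diamond :: "diamond \<Rightarrow> diamond \<Rightarrow> diamond" where
  "inf x y = (if x \<le> y then x else if y \<le> x then y else Zero)"

instance
  by standard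
    (auto simp: less_eq_diamond_def less_diamond_def sup_diamond_def inf_diamond_def)

end

definition M :: "nat \<Rightarrow> diamond set" where
  "M n = {Zero, One} \<union> Atom ` {..<n}"

lemma sublattice_M: "sublattice (M n)"
  by (auto simp: sublattice_def M_def sup_diamond_def inf_diamond_def)

lemma card_M: "card (M n) = n + 2"
proof -
  have "card (Atom ` {..<n}) = n"
    by (simp add: card_image inj_on_def)
  moreover have "Zero \<notin> Atom ` {..<n}" "One \<notin> Atom ` {..<n}"
    by auto
  ultimately show ?thesis
    by (simp add: M_def)
qed

lemma M_modular:
  fixes x y z :: diamond
  assumes "x \<le> z"
  shows "sup x (inf y z) = inf (sup x y) z"
  using assms
  by (cases x; cases y; cases z)
    (auto simp: less_eq_diamond_def sup_diamond_def inf_diamond_def)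

definition multi_diamond :: "'a::lattice set \<Rightarrow> bool" where
  "multi_diamond A \<longleftrightarrow> (\<exists>n\<ge>3. isomorphic_lattices A (M n))"

definition covering_multi_diamond :: "'a::lattice \<Rightarrow> 'a \<Rightarrow> bool" where
  "covering_multi_diamond lo hi \<longleftrightarrow> multi_diamond {lo..hi}"


definition covers :: "'a::order \<Rightarrow> 'a \<Rightarrow> bool" where
  "covers y x \<longleftrightarrow> x < y \<and> \<not> (\<exists>z. x < z \<and> z < y)"

definition doubly_irreducible :: "'a::lattice \<Rightarrow> bool" where
  "doubly_irreducible m \<longleftrightarrow> (\<exists>!x. covers m x) \<and> (\<exists>!y. covers y m)"

definition tab :: "'a::lattice \<Rightarrow> bool" where
  "tab m \<longleftrightarrow> doubly_irreducible m \<and>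
     (\<exists>lo hi. covering_multi_diamond lo hi \<and> m \<in> {lo..hi})"


definition congruence_on :: "'a::lattice set \<Rightarrow> 'a rel \<Rightarrow> bool" where
  "congruence_on S \<theta> \<longleftrightarrow> equiv S \<theta> \<and>
     (\<forall>a b c d. (a, b) \<in> \<theta> \<longrightarrow> (c, d) \<in> \<theta> \<longrightarrow>
        (sup a c, sup b d) \<in> \<theta> \<and> (inf a c, inf b d) \<in> \<theta>)"

(* Meaningful for a sublattice S and r a subset of S \<times> S (see con_least);
   otherwise the intersection may be over the empty family. *)
definition con :: "'a::lattice set \<Rightarrow> 'a rel \<Rightarrow> 'a rel" where
  "con S r = \<Inter>{\<theta>. congruence_on S \<theta> \<and> r \<subseteq> \<theta>}"

definition con_join :: "'a::lattice set \<Rightarrow> 'a rel \<Rightarrow> 'a rel \<Rightarrow> 'a rel" where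
  "con_join S \<theta> \<psi> = con S (\<theta> \<union> \<psi>)"

lemma congruence_on_full: "sublattice S \<Longrightarrow> congruence_on S (S \<times> S)"
  by (auto simp: sublattice_def congruence_on_def equiv_def refl_on_def sym_def trans_def)

lemma con_least:
  assumes "sublattice S" "r \<subseteq> S \<times> S"
  shows "congruence_on S (con S r)" "r \<subseteq> con S r"
    "\<And>\<theta>. congruence_on S \<theta> \<Longrightarrow> r \<subseteq> \<theta> \<Longrightarrow> con S r \<subseteq> \<theta>"
proof -
  let ?C = "{\<theta>. congruence_on S \<theta> \<and> r \<subseteq> \<theta>}"
  have full: "S \<times> S \<in> ?C"
    using assms congruence_on_full by blast
  have "equiv S (\<Inter>?C)"
  proof (rule equivI)
    show "\<Inter>?C \<subseteq> S \<times> S" using full by blast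
    show "refl_on S (\<Inter>?C)"
      using full by (auto simp: congruence_on_def equiv_def refl_on_def)
    show "sym (\<Inter>?C)"
      by (rule symI) (auto simp: congruence_on_def equiv_def dest: symD)
    show "trans (\<Inter>?C)"
      by (rule transI) (auto simp: congruence_on_def equiv_def dest: transD)
  qed
  then show "congruence_on S (con S r)"
    unfolding con_def congruence_on_def[of S "\<Inter>?C"]
    by (auto simp: congruence_on_def)
qed (auto simp: con_def)

lemma finite_lower_cover:
  fixes x m :: "'a::{finite,lattice}"
  assumes "x < m"
  shows "\<exists>c. covers m c \<and> x \<le> c"
proof -
  have "finite {z. x \<le> z \<and> z < m}" "x \<in> {z. x \<le> z \<and> z < m}"
    using assms by auto
  then obtain c where "c \<in> {z. x \<le> z \<and> z < m}"
      "\<And>z. z \<in> {z. x \<le> z \<and> z < m} \<Longrightarrow> c \<le> z \<Longrightarrow> c = z"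
    using finite_has_maximal2[of "{z. x \<le> z \<and> z < m}" x] by metis
  then have "covers m c" "x \<le> c"
    by (auto simp: covers_def) (metis less_le order.trans)
  then show ?thesis by blast
qed

lemma finite_upper_cover:
  fixes x m :: "'a::{finite,lattice}"
  assumes "m < x"
  shows "\<exists>c. covers c m \<and> c \<le> x"
proof -
  have "finite {z. z \<le> x \<and> m < z}" "x \<in> {z. z \<le> x \<and> m < z}"
    using assms by auto
  then obtain c where "c \<in> {z. z \<le> x \<and> m < z}"
      "\<And>z. z \<in> {z. z \<le> x \<and> m < z} \<Longrightarrow> z \<le> c \<Longrightarrow> c = z"
    using finite_has_minimal2[of "{z. z \<le> x \<and> m < z}" x] by metis
  then have "covers c m" "c \<le> x"
    by (auto simp: covers_def) (metis less_le order.trans)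
  then show ?thesis by blast
qed

lemma sublattice_remove_doubly_irreducible:
  fixes m :: "'a::{finite,lattice}"
  assumes "doubly_irreducible m"
  shows "sublattice (UNIV - {m})"
proof -
  have "sup x y \<noteq> m" if "x \<noteq> m" "y \<noteq> m" for x y
  proof
    assume eq: "sup x y = m"
    then have "x < m" "y < m"
      using that by (auto simp: less_le)
    then obtain c where "covers m c" "x \<le> c" "y \<le> c"
      using assms finite_lower_cover unfolding doubly_irreducible_def by metis
    then have "m \<le> c" "c < m"
      using eq unfolding covers_def by auto
    then show False by simp
  qed
  moreover have "inf x y \<noteq> m" if "x \<noteq> m" "y \<noteq> m" for x y
  proof
    assume eq: "inf x y = m"
    then have "m < x" "m < y"
      using that by (auto simp: less_le)
    then obtain c where "covers c m" "c \<le> x" "c \<le> y"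
      using assms finite_upper_cover unfolding doubly_irreducible_def by metis
    then have "c \<le> m" "m < c"
      using eq unfolding covers_def by auto
    then show False by simp
  qed
  ultimately show ?thesis
    by (auto simp: sublattice_def)
qed

end

theory Submission
  imports Defs
begin

text \<open>
  The inclusions from right to left are immediate, because \<open>\<beta> \<inter> (K \<times> K)\<close> is a congruence
  of \<open>K\<close>. For the converse one extends a congruence of \<open>K\<close> to \<open>L\<close> without enlarging it on \<open>K\<close>.
  If \<open>o \<equiv> i\<close> holds, then \<open>m\<close> can be added to the class of \<open>i\<close>. If \<open>o \<equiv> i\<close> fails modulo \<open>\<beta>\<close>,
  then \<open>m\<close> can be added as a singleton class: this could only go wrong if \<open>\<alpha>\<close> identified an
  element below \<open>m\<close> with one not below \<open>m\<close> (or dually), but then \<open>\<beta>\<close> would identify \<open>m\<close>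
  with \<open>i\<close> (with \<open>o\<close>), hence also \<open>o\<close> with \<open>i\<close>, as multi-diamonds are simple.
\<close>

section \<open>Congruences on a sublattice and their restrictions\<close>

lemma congruence_onI:
  assumes eq: "equiv S \<theta>"
    and sup: "\<And>a b c. (a, b) \<in> \<theta> \<Longrightarrow> c \<in> S \<Longrightarrow> (sup a c, sup b c) \<in> \<theta>"
    and inf: "\<And>a b c. (a, b) \<in> \<theta> \<Longrightarrow> c \<in> S \<Longrightarrow> (inf a c, inf b c) \<in> \<theta>"
  shows "congruence_on S \<theta>"
  unfolding congruence_on_def
proof (intro conjI allI impI)
  fix a b c d assume ab: "(a, b) \<in> \<theta>" and cd: "(c, d) \<in> \<theta>"
  then have mem: "b \<in> S" "c \<in> S"
    using eq by (auto simp: equiv_def)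
  have "trans \<theta>" using eq by (simp add: equiv_def)
  \<comment> \<open>One argument is changed at a time: \<open>sup a c\<close> to
    \<open>sup b c\<close> to \<open>sup b d\<close>, and likewise for \<open>inf\<close>.\<close>
  then show "(sup a c, sup b d) \<in> \<theta>" "(inf a c, inf b d) \<in> \<theta>"
    using sup[OF ab mem(2)] sup[OF cd mem(1)] inf[OF ab mem(2)] inf[OF cd mem(1)]
    by (auto simp: sup_commute inf_commute dest: transD)
qed (rule eq)

lemma congruence_onD:
  assumes "congruence_on S \<theta>"
  shows congruence_on_subset: "\<theta> \<subseteq> S \<times> S"
    and congruence_on_refl: "\<And>x. x \<in> S \<Longrightarrow> (x, x) \<in> \<theta>"
    and congruence_on_sym: "\<And>x y. (x, y) \<in> \<theta> \<Longrightarrow> (y, x) \<in> \<theta>"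
    and congruence_on_trans: "\<And>x y z. (x, y) \<in> \<theta> \<Longrightarrow> (y, z) \<in> \<theta> \<Longrightarrow> (x, z) \<in> \<theta>"
    and congruence_on_sup:
      "\<And>x y z. (x, y) \<in> \<theta> \<Longrightarrow> z \<in> S \<Longrightarrow> (sup z x, sup z y) \<in> \<theta> \<and> (sup x z, sup y z) \<in> \<theta>"
    and congruence_on_inf:
      "\<And>x y z. (x, y) \<in> \<theta> \<Longrightarrow> z \<in> S \<Longrightarrow> (inf z x, inf z y) \<in> \<theta> \<and> (inf x z, inf y z) \<in> \<theta>"
  using assms unfolding congruence_on_def equiv_def refl_on_def
  by (blast dest: symD transD)+

lemma congruence_on_restrict:
  assumes "congruence_on UNIV \<theta>" "sublattice S"
  shows "congruence_on S (\<theta> \<inter> S \<times> S)"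
proof (rule congruence_onI)
  note \<theta>D = congruence_onD[OF assms(1)]
  show "equiv S (\<theta> \<inter> S \<times> S)"
    by (intro equivI refl_onI symI transI) (use \<theta>D(2) in \<open>blast dest: \<theta>D(3) \<theta>D(4)\<close>)+
  fix a b c assume "(a, b) \<in> \<theta> \<inter> S \<times> S" "c \<in> S"
  then show "(sup a c, sup b c) \<in> \<theta> \<inter> S \<times> S" "(inf a c, inf b c) \<in> \<theta> \<inter> S \<times> S"
    using \<theta>D(5,6)[of a b c] assms(2) unfolding sublattice_def by auto
qed

section \<open>Atoms of a covering multi-diamond\<close>

lemma diamond_less_eq_simps [simp]:
  "Zero \<le> x" "x \<le> One" "x \<le> Zero \<longleftrightarrow> x = Zero" "One \<le> x \<longleftrightarrow> x = One"
  "Atom i \<le> Atom j \<longleftrightarrow> i = j"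
  by (auto simp: less_eq_diamond_def)

text \<open>The isomorphism is monotone and injective, and every element of the lattice between two
  elements of the interval lies in the interval. Hence covers in the whole lattice can be read off
  from \<open>M n\<close>.\<close>

lemma isomorphic_M_atoms:
  fixes f :: "'a::lattice \<Rightarrow> diamond"
  assumes f: "lattice_iso f {lo..hi} (M n)"
  shows "\<And>x. x \<in> {lo..hi} \<Longrightarrow> f x = Zero \<Longrightarrow> x = lo"
    and "\<And>x. x \<in> {lo..hi} \<Longrightarrow> f x = One \<Longrightarrow> x = hi"
    and "\<And>x k. x \<in> {lo..hi} \<Longrightarrow> f x = Atom k \<Longrightarrow> covers x lo \<and> covers hi x"
    and "\<And>x y i j. x \<in> {lo..hi} \<Longrightarrow> y \<in> {lo..hi} \<Longrightarrow> f x = Atom i \<Longrightarrow> f y = Atom j \<Longrightarrow> i \<noteq> j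
      \<Longrightarrow> sup x y = hi \<and> inf x y = lo"
proof -
  have inj: "inj_on f {lo..hi}" and img: "f ` {lo..hi} = M n"
    and sup: "\<And>x y. x \<in> {lo..hi} \<Longrightarrow> y \<in> {lo..hi} \<Longrightarrow> f (sup x y) = sup (f x) (f y)"
    and inf: "\<And>x y. x \<in> {lo..hi} \<Longrightarrow> y \<in> {lo..hi} \<Longrightarrow> f (inf x y) = inf (f x) (f y)"
    using f unfolding lattice_iso_def bij_betw_def by auto
  have mono: "f x \<le> f y" if "x \<in> {lo..hi}" "y \<in> {lo..hi}" "x \<le> y" for x y
    using sup[OF that(1,2)] that(3) by (simp add: sup.absorb2 le_iff_sup)
  have eqD: "x = y" if "x \<in> {lo..hi}" "y \<in> {lo..hi}" "f x = f y" for x y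
    using inj that by (auto dest: inj_onD)
  \<comment> \<open>Preimages of the bounds show that the interval is nonempty, so it contains
    \<open>lo\<close> and \<open>hi\<close>; monotonicity then forces their images.\<close>
  have "Zero \<in> f ` {lo..hi}" "One \<in> f ` {lo..hi}"
    using img by (auto simp: M_def)
  then obtain z u where z: "z \<in> {lo..hi}" "f z = Zero" and u: "u \<in> {lo..hi}" "f u = One"
    by (metis imageE)
  have bounds: "lo \<in> {lo..hi}" "hi \<in> {lo..hi}"
    using z by auto
  have lo: "f lo = Zero" and hi: "f hi = One"
    using mono[of lo z] mono[of u hi] bounds z u by auto
  show zero: "x = lo" if "x \<in> {lo..hi}" "f x = Zero" for x
    using eqD[of x lo] bounds that lo by simp
  show one: "x = hi" if "x \<in> {lo..hi}" "f x = One" for x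
    using eqD[of x hi] bounds that hi by simp
  show "covers x lo \<and> covers hi x" if x: "x \<in> {lo..hi}" "f x = Atom k" for x k
  proof -
    have "x \<noteq> lo" "x \<noteq> hi" using x lo hi by auto
    moreover have False if "lo < y" "y < x" for y
    proof -
      have y: "y \<in> {lo..hi}" using that x by auto
      have "f y \<le> Atom k" using mono[OF y x(1)] that x by simp
      then have "f y = Zero \<or> f y = f x" using x by (cases "f y") auto
      then show False using zero[OF y] eqD[OF y x(1)] that by auto
    qed
    moreover have False if "x < y" "y < hi" for y
    proof -
      have y: "y \<in> {lo..hi}" using that x by auto
      have "Atom k \<le> f y" using mono[OF x(1) y] that x by simp
      then have "f y = One \<or> f y = f x" using x by (cases "f y") auto
      then show False using one[OF y] eqD[OF y x(1)] that by auto
    qed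
    ultimately show ?thesis
      using x(1) unfolding covers_def by (auto simp: less_le)
  qed
  show "sup x y = hi \<and> inf x y = lo"
    if "x \<in> {lo..hi}" "y \<in> {lo..hi}" "f x = Atom i" "f y = Atom j" "i \<noteq> j" for x y i j
  proof
    have "f (sup x y) = One" "f (inf x y) = Zero"
      using sup inf that by (auto simp: sup_diamond_def inf_diamond_def)
    moreover have "sup x y \<in> {lo..hi}" "inf x y \<in> {lo..hi}"
      using that by (auto simp: le_supI1 le_infI1)
    ultimately show "sup x y = hi" "inf x y = lo"
      using one zero by blast+
  qed
qed

section \<open>Extending congruences over an element with a single lower and a single upper
  cover\<close>

text \<open>Unique covers are expressed through the order alone, which makes the locale independent
  of finiteness and self-dual under exchanging \<open>lo\<close> and \<open>hi\<close>.\<close>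

locale irreducible_element =
  fixes m lo hi :: "'a::lattice"
  assumes less_iff: "y < m \<longleftrightarrow> y \<le> lo"
    and greater_iff: "m < y \<longleftrightarrow> hi \<le> y"
begin

lemma less: "lo < m" "m < hi"
  by (simp_all add: less_iff greater_iff)

text \<open>Whatever lies strictly above \<open>m\<close> lies above \<open>hi\<close>, so a join
  that leaves \<open>m\<close> can be computed with \<open>hi\<close> instead. Thus operations with
  \<open>m\<close> reduce to operations among the other elements.\<close>

lemma sup_elem:
  assumes "y \<noteq> m"
  shows "sup m y = (if y \<le> m then m else sup hi y)"
proof (cases "y \<le> m")
  case False
  then have "m < sup m y" by (simp add: less_le_not_le)
  then have "hi \<le> sup m y" by (simp add: greater_iff)
  then have "sup hi y \<le> sup m y" by simp
  moreover have "sup m y \<le> sup hi y"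
    using less(2) by (intro sup_mono) auto
  ultimately show ?thesis using False by (simp add: antisym)
qed (simp add: sup.absorb1)

lemma inf_elem:
  assumes "y \<noteq> m"
  shows "inf m y = (if m \<le> y then m else inf lo y)"
proof (cases "m \<le> y")
  case False
  then have "inf m y < m" by (simp add: less_le_not_le)
  then have "inf m y \<le> lo" by (simp add: less_iff)
  then have "inf m y \<le> inf lo y" by simp
  moreover have "inf lo y \<le> inf m y"
    using less(1) by (intro inf_mono) auto
  ultimately show ?thesis using False by (simp add: antisym)
qed (simp add: inf.absorb1)

text \<open>Two elements strictly below \<open>m\<close> are both below \<open>lo\<close>, and so is
  their join; dually for meets.\<close>

lemma sublattice: "sublattice (UNIV - {m})"
proof -
  have "sup x y \<noteq> m" if "x \<noteq> m" "y \<noteq> m" for x y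
    using that less_iff[of x] less_iff[of y] less_iff[of "sup x y"]
    by (metis less_le sup.bounded_iff sup.cobounded1 sup.cobounded2)
  moreover have "inf x y \<noteq> m" if "x \<noteq> m" "y \<noteq> m" for x y
    using that greater_iff[of x] greater_iff[of y] greater_iff[of "inf x y"]
    by (metis less_le inf.bounded_iff inf.cobounded1 inf.cobounded2)
  ultimately show ?thesis by (simp add: sublattice_def)
qed

text \<open>Only translations by \<open>m\<close> need care. By \<open>below\<close>, joining
  related elements with \<open>m\<close> gives \<open>m\<close> in both cases or amounts to joining
  both with \<open>hi\<close>, which \<alpha> respects; \<open>above\<close> serves meets in the
  same way.\<close>

lemma congruence_on_add_singleton:
  assumes \<alpha>: "congruence_on (UNIV - {m}) \<alpha>"
    and below: "\<And>x y. (x, y) \<in> \<alpha> \<Longrightarrow> x \<le> m \<Longrightarrow> y \<le> m"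
    and above: "\<And>x y. (x, y) \<in> \<alpha> \<Longrightarrow> m \<le> x \<Longrightarrow> m \<le> y"
  shows "congruence_on UNIV (insert (m, m) \<alpha>)"
proof (rule congruence_onI)
  note \<alpha>D = congruence_onD[OF \<alpha>]
  show "equiv UNIV (insert (m, m) \<alpha>)"
    using \<alpha>D(1,2) by (intro equivI refl_onI symI transI) (auto intro: \<alpha>D(3,4))
  have bounds: "lo \<in> UNIV - {m}" "hi \<in> UNIV - {m}"
    using less by auto
  fix a b c assume ab: "(a, b) \<in> insert (m, m) \<alpha>"
  have refl: "(x, x) \<in> insert (m, m) \<alpha>" for x
    using \<alpha>D(2)[of x] by blast
  show "(sup a c, sup b c) \<in> insert (m, m) \<alpha>"
  proof (cases "a = m \<and> b = m")
    case True then show ?thesis by (simp only: refl)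
  next
    case False
    then have ab: "(a, b) \<in> \<alpha>" using ab by blast
    then have ne: "a \<noteq> m" "b \<noteq> m" using \<alpha>D(1) by auto
    show ?thesis
    proof (cases "c = m")
      case True
      have "a \<le> m \<longleftrightarrow> b \<le> m"
        using below ab \<alpha>D(3) by blast
      then show ?thesis
        using True ne \<alpha>D(5)[OF ab bounds(2)] sup_elem by (simp add: sup_commute)
    qed (use \<alpha>D(5)[OF ab, of c] in auto)
  qed
  show "(inf a c, inf b c) \<in> insert (m, m) \<alpha>"
  proof (cases "a = m \<and> b = m")
    case True then show ?thesis by (simp only: refl)
  next
    case False
    then have ab: "(a, b) \<in> \<alpha>" using ab by blast
    then have ne: "a \<noteq> m" "b \<noteq> m" using \<alpha>D(1) by auto
    show ?thesis
    proof (cases "c = m")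
      case True
      have "m \<le> a \<longleftrightarrow> m \<le> b"
        using above ab \<alpha>D(3) by blast
      then show ?thesis
        using True ne \<alpha>D(6)[OF ab bounds(1)] inf_elem by (simp add: inf_commute)
    qed (use \<alpha>D(6)[OF ab, of c] in auto)
  qed
qed

text \<open>The new relation is the pullback of \<gamma> along the retraction \<open>f\<close>,
  which is a homomorphism modulo \<gamma>. Joins are preserved exactly; \<open>lohi\<close> enters
  only for meets, where \<open>inf lo y\<close> has to be related to
  \<open>inf hi y\<close>.\<close>

lemma congruence_on_add_to_class:
  assumes \<gamma>: "congruence_on (UNIV - {m}) \<gamma>" and lohi: "(lo, hi) \<in> \<gamma>"
  defines "f \<equiv> \<lambda>x. if x = m then hi else x"
  shows "congruence_on UNIV {(x, y). (f x, f y) \<in> \<gamma>}"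
proof -
  note \<gamma>D = congruence_onD[OF \<gamma>]
  have f: "f x \<in> UNIV - {m}" for x
    using less by (auto simp: f_def)
  have closed: "sup x y \<in> UNIV - {m}" "inf x y \<in> UNIV - {m}" if "x \<noteq> m" "y \<noteq> m" for x y
    using sublattice that unfolding sublattice_def by auto
  have sup_m: "(f (sup m y), sup (f m) (f y)) \<in> \<gamma>" if "y \<noteq> m" for y
  proof (cases "y \<le> m")
    case True
    then have "y \<le> hi" using less(2) by (meson less_imp_le order.trans)
    then show ?thesis
      using True \<gamma>D(2)[of hi] less by (simp add: f_def sup.absorb1)
  next
    case False
    then show ?thesis
      using \<gamma>D(2)[OF closed(1)[of hi y]] closed(1)[of hi y] that less
      by (simp add: f_def sup_elem)
  qed
  have inf_m: "(f (inf m y), inf (f m) (f y)) \<in> \<gamma>" if "y \<noteq> m" for y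
  proof (cases "m \<le> y")
    case True
    then have "hi \<le> y" using that greater_iff[of y] by (simp add: less_le)
    then show ?thesis
      using True \<gamma>D(2)[of hi] less by (simp add: f_def inf.absorb1)
  next
    case False
    then show ?thesis
      using \<gamma>D(6)[OF lohi, of y] closed(2)[of lo y] that less
      by (simp add: f_def inf_elem)
  qed
  have sup: "(f (sup x y), sup (f x) (f y)) \<in> \<gamma>" for x y
  proof (cases "x = m \<or> y = m")
    case True
    then show ?thesis
      using sup_m[of x] sup_m[of y] \<gamma>D(2)[OF f] by (cases "x = y") (auto simp: sup_commute)
  next
    case False
    then show ?thesis using closed(1)[of x y] \<gamma>D(2) by (auto simp: f_def)
  qed
  have inf: "(f (inf x y), inf (f x) (f y)) \<in> \<gamma>" for x y
  proof (cases "x = m \<or> y = m")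
    case True
    then show ?thesis
      using inf_m[of x] inf_m[of y] \<gamma>D(2)[OF f] by (cases "x = y") (auto simp: inf_commute)
  next
    case False
    then show ?thesis using closed(2)[of x y] \<gamma>D(2) by (auto simp: f_def)
  qed
  show ?thesis
  proof (rule congruence_onI)
    show "equiv UNIV {(x, y). (f x, f y) \<in> \<gamma>}"
      using \<gamma>D(2)[OF f] by (intro equivI refl_onI symI transI) (auto intro: \<gamma>D(3,4))
    fix a b c assume "(a, b) \<in> {(x, y). (f x, f y) \<in> \<gamma>}"
    then have ab: "(f a, f b) \<in> \<gamma>" by simp
    \<comment> \<open>The chain is \<open>f (sup a c)\<close>, \<open>sup (f a) (f c)\<close>,
      \<open>sup (f b) (f c)\<close>, \<open>f (sup b c)\<close>.\<close>
    show "(sup a c, sup b c) \<in> {(x, y). (f x, f y) \<in> \<gamma>}"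
      using \<gamma>D(4)[OF \<gamma>D(4)[OF sup conjunct2[OF \<gamma>D(5)[OF ab f]]] \<gamma>D(3)[OF sup]] by simp
    show "(inf a c, inf b c) \<in> {(x, y). (f x, f y) \<in> \<gamma>}"
      using \<gamma>D(4)[OF \<gamma>D(4)[OF inf conjunct2[OF \<gamma>D(6)[OF ab f]]] \<gamma>D(3)[OF inf]] by simp
  qed
qed

end

section \<open>A tab is an atom of its multi-diamond\<close>

text \<open>Supplies what the theorem needs of a tab: its covers are the bounds of the interval, and
  there are two further atoms \<open>a\<close> and \<open>b\<close>, available since
  \<open>n\<close> is at least 3.\<close>

lemma tab_in_multi_diamond:
  fixes m lo hi :: "'a::{finite,lattice}"
  assumes "tab m" and cmd: "covering_multi_diamond lo hi" and m: "m \<in> {lo..hi}"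
  obtains a b where "irreducible_element m lo hi"
    "sup m a = hi" "sup m b = hi" "sup a b = hi" "inf m a = lo" "inf m b = lo" "inf a b = lo"
proof -
  have irr: "\<And>x y. covers m x \<Longrightarrow> covers m y \<Longrightarrow> x = y" "\<And>x y. covers x m \<Longrightarrow> covers y m \<Longrightarrow> x = y"
    using assms(1) unfolding tab_def doubly_irreducible_def by blast+
  obtain n f where n: "n \<ge> 3" and f: "lattice_iso f {lo..hi} (M n)"
    using cmd unfolding covering_multi_diamond_def multi_diamond_def isomorphic_lattices_def
    by blast
  have img: "f ` {lo..hi} = M n"
    using f by (simp add: lattice_iso_def bij_betw_def)
  have atom: "\<exists>x\<in>{lo..hi}. f x = Atom k" if "k < n" for k
  proof -
    have "Atom k \<in> f ` {lo..hi}" using that img by (simp add: M_def)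
    then show ?thesis by fastforce
  qed
  note fD = isomorphic_M_atoms[OF f]
  obtain p q where p: "p \<in> {lo..hi}" "f p = Atom 0" and q: "q \<in> {lo..hi}" "f q = Atom 1"
    using atom[of 0] atom[of 1] n by auto
  \<comment> \<open>Two distinct atoms would be two upper covers of \<open>m\<close> if
    \<open>m\<close> were \<open>lo\<close>, and two lower covers if \<open>m\<close> were
    \<open>hi\<close>.\<close>
  have "p \<noteq> q" using p q by auto
  then have "m \<noteq> lo" "m \<noteq> hi"
    using fD(3)[OF p] fD(3)[OF q] irr by blast+
  then obtain k where k: "f m = Atom k"
    using fD(1,2)[OF m] by (cases "f m") auto
  have cov: "covers m lo" "covers hi m"
    using fD(3)[OF m k] by auto
  have irr_elem: "irreducible_element m lo hi"
  proof
    fix y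
    show "y < m \<longleftrightarrow> y \<le> lo"
    proof
      assume "y < m"
      then obtain c where "covers m c" "y \<le> c" using finite_lower_cover by blast
      then show "y \<le> lo" using irr(1) cov(1) by blast
    next
      assume "y \<le> lo"
      then show "y < m" using cov(1) unfolding covers_def by auto
    qed
    show "m < y \<longleftrightarrow> hi \<le> y"
    proof
      assume "m < y"
      then obtain c where "covers c m" "c \<le> y" using finite_upper_cover by blast
      then show "hi \<le> y" using irr(2) cov(2) by blast
    next
      assume "hi \<le> y"
      then show "m < y" using cov(2) unfolding covers_def by auto
    qed
  qed
  \<comment> \<open>Two distinct indices among 0, 1, 2 that avoid \<open>k\<close>.\<close>
  define i j :: nat where "i = (if k = 0 then 1 else 0)" and "j = (if k = 2 then 1 else 2)"
  then have "i < n" "j < n" "k \<noteq> i" "k \<noteq> j" "i \<noteq> j"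
    using n by auto
  moreover obtain a b where "a \<in> {lo..hi}" "f a = Atom i" "b \<in> {lo..hi}" "f b = Atom j"
    using atom[OF \<open>i < n\<close>] atom[OF \<open>j < n\<close>] by blast
  ultimately show ?thesis
    using that[OF irr_elem, of a b]
      fD(4)[OF m _ k, of a i] fD(4)[OF m _ k, of b j] fD(4)[of a b i j] by simp
qed

section \<open>The restriction of \<beta> in the two cases\<close>

theorem lemma12:
  fixes m lo hi :: "'a::{finite,lattice}"
    and K :: "'a set"
    and \<alpha> \<beta> :: "'a rel"
  assumes "tab m"
    and "covering_multi_diamond lo hi"
    and "m \<in> {lo..hi}"
    and "K = UNIV - {m}"
    and "congruence_on K \<alpha>"
    and "\<beta> = con UNIV \<alpha>"
  shows "\<beta> \<inter> (K \<times> K) =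
    (if (lo, hi) \<notin> \<beta> then \<alpha> else con_join K \<alpha> (con K {(lo, hi)}))"
proof -
  obtain a b where "irreducible_element m lo hi"
    and ab: "sup m a = hi" "sup m b = hi" "sup a b = hi" "inf m a = lo" "inf m b = lo" "inf a b = lo"
    using tab_in_multi_diamond[OF assms(1-3)] .
  then interpret irreducible_element m lo hi by simp
  have bnds: "lo \<le> a" "a \<le> hi" "lo \<le> b" "b \<le> hi"
    using sup_ge2[of a m] sup_ge2[of b m] inf_le2[of m a] inf_le2[of m b] unfolding ab by auto
  have K: "sublattice K" using sublattice assms(4) by simp
  have lohi: "lo \<in> K" "hi \<in> K" using less assms(4) by auto
  note \<alpha>D = congruence_onD[OF assms(5)]
  have UNIV: "sublattice (UNIV :: 'a set)" by (simp add: sublattice_def)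
  have \<beta>: "congruence_on UNIV \<beta>" "\<alpha> \<subseteq> \<beta>" and \<beta>_least: "\<And>\<theta>. congruence_on UNIV \<theta> \<Longrightarrow> \<alpha> \<subseteq> \<theta> \<Longrightarrow> \<beta> \<subseteq> \<theta>"
    using con_least[OF UNIV, of \<alpha>] assms(6) by auto
  note \<beta>D = congruence_onD[OF \<beta>(1)]
  have \<beta>K: "congruence_on K (\<beta> \<inter> K \<times> K)"
    by (rule congruence_on_restrict[OF \<beta>(1) K])
  \<comment> \<open>Simplicity of the multi-diamond, in three translations: meeting with
    \<open>a\<close> gives \<open>lo\<close> ~ \<open>a\<close>, joining with \<open>b\<close> gives
    \<open>b\<close> ~ \<open>hi\<close>, and meeting with \<open>m\<close> gives \<open>lo\<close>
    ~ \<open>m\<close>. The fact \<open>lo\<close> below is dual.\<close>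
  have hi: "(lo, hi) \<in> \<beta>" if "(m, hi) \<in> \<beta>"
  proof -
    have "inf a hi = a" "sup b lo = b" "sup b a = hi" "inf m hi = m"
      using bnds less ab(3,6)
      by (simp_all add: sup.absorb1 sup.absorb2 inf.absorb1 inf.absorb2 sup_commute inf_commute)
    have "(lo, a) \<in> \<beta>"
      using \<beta>D(6)[OF that, of a] ab \<open>inf a hi = a\<close> by (simp add: inf_commute)
    then have "(b, hi) \<in> \<beta>"
      using \<beta>D(5)[of lo a b] \<open>sup b lo = b\<close> \<open>sup b a = hi\<close> by simp
    then have "(lo, m) \<in> \<beta>"
      using \<beta>D(6)[of b hi m] ab \<open>inf m hi = m\<close> by simp
    then show ?thesis using that \<beta>D(4) by blast
  qed
  have lo: "(lo, hi) \<in> \<beta>" if "(lo, m) \<in> \<beta>"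
  proof -
    have "sup a lo = a" "inf b hi = b" "inf b a = lo" "sup m lo = m"
      using bnds less ab(3,6)
      by (simp_all add: sup.absorb1 sup.absorb2 inf.absorb1 inf.absorb2 sup_commute inf_commute)
    have "(a, hi) \<in> \<beta>"
      using \<beta>D(5)[OF that, of a] ab \<open>sup a lo = a\<close> by (simp add: sup_commute)
    then have "(lo, b) \<in> \<beta>"
      using \<beta>D(6)[of a hi b] \<open>inf b hi = b\<close> \<open>inf b a = lo\<close> by simp
    then have "(m, hi) \<in> \<beta>"
      using \<beta>D(5)[of lo b m] ab \<open>sup m lo = m\<close> by simp
    then show ?thesis using that \<beta>D(4) by blast
  qed
  show ?thesis
  proof (cases "(lo, hi) \<in> \<beta>")
    case False
    have "y \<le> m" if xy: "(x, y) \<in> \<alpha>" "x \<le> m" for x y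
    proof (rule ccontr)
      assume "\<not> y \<le> m"
      then have "y \<noteq> m" by auto
      \<comment> \<open>Joining with \<open>m\<close> gives \<open>m\<close> ~
        \<open>sup hi y\<close>; meeting with \<open>hi\<close> brings this back into the interval
        as \<open>m\<close> ~ \<open>hi\<close>.\<close>
      have "(sup m x, sup m y) \<in> \<beta>" using \<beta>D(5) \<beta>(2) xy(1) by blast
      then have "(m, sup hi y) \<in> \<beta>"
        using xy(2) sup_elem[OF \<open>y \<noteq> m\<close>] \<open>\<not> y \<le> m\<close> by (simp add: sup.absorb1)
      then have "(inf hi m, inf hi (sup hi y)) \<in> \<beta>" using \<beta>D(6) by blast
      then have "(m, hi) \<in> \<beta>" using less(2) by (simp add: inf.absorb2)
      then show False using hi False by blast
    qed
    moreover have "m \<le> y" if xy: "(x, y) \<in> \<alpha>" "m \<le> x" for x y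
    proof (rule ccontr)
      assume "\<not> m \<le> y"
      then have "y \<noteq> m" by auto
      have "(inf m x, inf m y) \<in> \<beta>" using \<beta>D(6) \<beta>(2) xy(1) by blast
      then have "(m, inf lo y) \<in> \<beta>"
        using xy(2) inf_elem[OF \<open>y \<noteq> m\<close>] \<open>\<not> m \<le> y\<close> by (simp add: inf.absorb1)
      then have "(sup lo m, sup lo (inf lo y)) \<in> \<beta>" using \<beta>D(5) by blast
      then have "(m, lo) \<in> \<beta>" using less(1) by (simp add: sup.absorb2)
      then show False using lo False \<beta>D(3) by blast
    qed
    ultimately have "congruence_on UNIV (insert (m, m) \<alpha>)"
      using congruence_on_add_singleton assms(4,5) by blast
    then have "\<beta> \<subseteq> insert (m, m) \<alpha>" using \<beta>_least by blast
    then have "\<beta> \<inter> K \<times> K = \<alpha>" using \<alpha>D(1) \<beta>(2) assms(4) by blast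
    then show ?thesis using False by simp
  next
    case True
    define \<gamma> where "\<gamma> = con_join K \<alpha> (con K {(lo, hi)})"
    \<comment> \<open>Both generating relations must lie in \<open>K \<times> K\<close> for
      \<open>con_least\<close> to apply: first the single pair, then its union with
      \<alpha>.\<close>
    have "{(lo, hi)} \<subseteq> K \<times> K" using lohi by auto
    note \<delta> = con_least[OF K this]
    have "\<alpha> \<union> con K {(lo, hi)} \<subseteq> K \<times> K"
      using \<alpha>D(1) congruence_on_subset[OF \<delta>(1)] by blast
    note con = con_least[OF K this, folded con_join_def, folded \<gamma>_def]
    have "\<gamma> \<subseteq> \<beta> \<inter> K \<times> K"
    proof (rule con(3)[OF \<beta>K])
      have "con K {(lo, hi)} \<subseteq> \<beta> \<inter> K \<times> K"
        using \<delta>(3)[OF \<beta>K] True lohi by blast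
      then show "\<alpha> \<union> con K {(lo, hi)} \<subseteq> \<beta> \<inter> K \<times> K"
        using \<beta>(2) \<alpha>D(1) by blast
    qed
    moreover have "\<beta> \<inter> K \<times> K \<subseteq> \<gamma>"
    proof -
      have "(lo, hi) \<in> \<gamma>" using con(2) \<delta>(2) by blast
      then have ext: "congruence_on UNIV {(x, y). (if x = m then hi else x, if y = m then hi else y) \<in> \<gamma>}"
        using congruence_on_add_to_class con(1) assms(4) by blast
      \<comment> \<open>The retraction fixes \<open>K\<close> pointwise, so the pulled-back
        congruence contains \<alpha>, hence \<beta>, and agrees with \<gamma> on
        \<open>K\<close>.\<close>
      have "\<beta> \<subseteq> {(x, y). (if x = m then hi else x, if y = m then hi else y) \<in> \<gamma>}"
        by (rule \<beta>_least[OF ext]) (use con(2) \<alpha>D(1) assms(4) in auto)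
      then show ?thesis using assms(4) by (auto dest: subsetD split: if_splits)
    qed
    ultimately show ?thesis using True \<gamma>_def by auto
  qed
qed

end
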